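(* Let $H$ be a real Hilbert space and let $\gamma:\mathbb{R}\to\mathbb{P}(H)$ be a continuous, injective map such that its image $\gamma(\mathbb{R})$ does not change its isometry type under spherical projections. Then $\gamma(\mathbb{R})$ (with the metric $\rho$) is isometric to $\{h(t):t\in J\}$, where $h$ is the helix and $J\subset\mathbb{R}$ is an open interval (which may be bounded, half-infinite or equal to $\mathbb{R}$).
   Context: For a real Hilbert space $H$, let $\mathbb{S}(H)=\{x\in H:\|x\|=1\}$ and let $\mathbb{P}(H)=\mathbb{S}(H)/\pm$ be obtained by identifying $x$ and $-x$ for all $x\in\mathbb{S}(H)$; its elements are denoted $\pm x$. It carries the metric $\rho(\pm x,\pm y)=\arccos|\langle x,y\rangle|$ and the induced topology. For $x_0\in\mathbb{S}(H)$ let $x_0^\perp=\{x\in H:\langle x,x_0\rangle=0\}$. The spherical projection $p_{\pm x_0}:\mathbb{P}(H)\setminus\{\pm x_0\}\to\mathbb{P}(x_0^\perp)$ is $$p_{\pm x_0}(\pm y)=\pm\frac{y-x_0\langle x_0,y\rangle}{\sqrt{1-\langle x_0,y\rangle^2}}.$$ A set $S\subset\mathbb{P}(H)$ does not change its isometry type under spherical projections if for all $\pm s_0\in S$ and all $\pm x,\pm y\in S\setminus\{\pm s_0\}$ one has $\rho(p_{\pm s_0}(\pm x),p_{\pm s_0}(\pm y))=\rho(\pm x,\pm y)$. Helix: a family $\{h(t)\}_{t\in\mathbb{R}}$ of points of an infinite-dimensional projective Hilbert space (not necessarily $\mathbb{P}(H)$) with $|\langle h(s),h(t)\rangle|=\frac{1}{\cosh(t-s)}$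 for all $s,t\in\mathbb{R}$. (Such a family exists, and it is unique up to isometry with respect to the metric $\rho$.) *)

theory Defs
  imports "HOL-Analysis.Analysis"
begin

section \<open>Projective Hilbert space\<close>

text \<open>
  The point \<open>\<plusminus>x\<close> is represented by the set \<open>{x, -x}\<close>, the class of \<open>x\<close> in the
  quotient of the unit sphere by the antipodal identification.  (A quotient type is not available:
  the unit sphere of the zero space is empty.)
\<close>

definition pm :: "'a::real_inner \<Rightarrow> 'a set" where
  "pm x = {x, - x}"

definition proj_space :: "'a::real_inner set set" where
  "proj_space = pm ` sphere 0 1"

lemma proj_space_quotient:
  "proj_space = (sphere 0 1 :: 'a::real_inner set) //
     {(x, y). x \<in> sphere 0 1 \<and> y \<in> sphere 0 1 \<and> (y = x \<or> y = - x)}"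
proof -
  have "{(x, y). x \<in> sphere 0 1 \<and> y \<in> sphere 0 1 \<and> (y = x \<or> y = - x)} `` {x} = pm x"
    if "x \<in> sphere 0 1" for x :: 'a
    using that by (auto simp: pm_def)
  then show ?thesis
    by (simp add: proj_space_def quotient_def image_UN[symmetric] UNION_singleton_eq_range)
qed

definition rep :: "'a::real_inner set \<Rightarrow> 'a" where
  "rep P = (SOME x. x \<in> P)"

text \<open>The quantity \<open>\<bar>\<langle>x, y\<rangle>\<bar>\<close> for \<open>P = \<plusminus>x\<close> and \<open>Q = \<plusminus>y\<close>; see \<open>abs_inner_pm\<close>
  for the independence of the choice of representatives.\<close>

definition abs_inner :: "'a::real_inner set \<Rightarrow> 'a set \<Rightarrow> real" where
  "abs_inner P Q = \<bar>rep P \<bullet> rep Q\<bar>"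

text \<open>The value 0 outside of \<open>proj_space\<close> is a dummy: the locale \<open>Metric_space\<close> wants a metric
  to be nonnegative and symmetric on the whole type.\<close>

definition rho :: "'a::real_inner set \<Rightarrow> 'a set \<Rightarrow> real" where
  "rho P Q = (if P \<in> proj_space \<and> Q \<in> proj_space then arccos (abs_inner P Q) else 0)"

abbreviation proj_topology :: "'a::real_inner set topology" where
  "proj_topology \<equiv> Metric_space.mtopology proj_space rho"

text \<open>\<open>sph_proj P Q\<close> is \<open>p\<^bsub>P\<^esub>(Q)\<close>, meaningful for distinct points \<open>P\<close> and \<open>Q\<close>.  Its values lie in
  the projective space of the orthogonal complement of \<open>P\<close>, a subset of \<open>proj_space\<close> whose metric
  is the restriction of \<open>rho\<close>.\<close>

definition sph_proj :: "'a::real_inner set \<Rightarrow> 'a set \<Rightarrow> 'a set" where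
  "sph_proj P Q = (let x = rep P; y = rep Q in
     pm ((y - (x \<bullet> y) *\<^sub>R x) /\<^sub>R sqrt (1 - (x \<bullet> y)\<^sup>2)))"

definition isometry_type_unchanged :: "'a::real_inner set set \<Rightarrow> bool" where
  "isometry_type_unchanged S \<longleftrightarrow>
     (\<forall>P\<in>S. \<forall>Q\<in>S - {P}. \<forall>R\<in>S - {P}. rho (sph_proj P Q) (sph_proj P R) = rho Q R)"

definition rho_isometric :: "'a::real_inner set set \<Rightarrow> 'b::real_inner set set \<Rightarrow> bool" where
  "rho_isometric S T \<longleftrightarrow>
     (\<exists>f. bij_betw f S T \<and> (\<forall>P\<in>S. \<forall>Q\<in>S. rho (f P) (f Q) = rho P Q))"

definition helix :: "(real \<Rightarrow> 'a::{real_inner,complete_space} set) \<Rightarrow> bool" where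
  "helix h \<longleftrightarrow>
     (\<nexists>B. finite B \<and> span B = (UNIV :: 'a set)) \<and>
     (\<forall>t. h t \<in> proj_space) \<and>
     (\<forall>s t. abs_inner (h s) (h t) = 1 / cosh (t - s))"


section \<open>Independence of representatives\<close>

lemma pm_eq_iff: "pm x = pm y \<longleftrightarrow> x = y \<or> x = - y"
  by (auto simp: pm_def doubleton_eq_iff)

lemma pm_minus [simp]: "pm (- x) = pm x"
  by (simp add: pm_eq_iff)

lemma rep_pm: "rep (pm x) = x \<or> rep (pm x) = - x"
  unfolding rep_def pm_def by (rule someI2[of _ x]) auto

lemma proj_space_cases:
  assumes "P \<in> proj_space"
  obtains x where "norm x = 1" "P = pm x"
  using assms by (auto simp: proj_space_def)

lemma pm_in_proj_space: "norm x = 1 \<Longrightarrow> pm x \<in> proj_space"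
  by (auto simp: proj_space_def)

lemma abs_inner_pm: "abs_inner (pm x) (pm y) = \<bar>x \<bullet> y\<bar>"
  using rep_pm[of x] rep_pm[of y] by (auto simp: abs_inner_def)

lemma rho_pm: "norm x = 1 \<Longrightarrow> norm y = 1 \<Longrightarrow> rho (pm x) (pm y) = arccos \<bar>x \<bullet> y\<bar>"
  by (simp add: rho_def abs_inner_pm pm_in_proj_space)

lemma sph_proj_pm:
  "sph_proj (pm x) (pm y) = pm ((y - (x \<bullet> y) *\<^sub>R x) /\<^sub>R sqrt (1 - (x \<bullet> y)\<^sup>2))"
proof -
  have *: "- y - (- a) = - (y - a)" for a :: 'a by simp
  have "pm ((- y - (- (x \<bullet> y)) *\<^sub>R x) /\<^sub>R c) = pm ((y - (x \<bullet> y) *\<^sub>R x) /\<^sub>R c)" for c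
    by (simp only: scaleR_minus_left * scaleR_minus_right pm_minus)
  then show ?thesis
    using rep_pm[of x] rep_pm[of y] by (auto simp: sph_proj_def Let_def)
qed

lemma abs_inner_le_one: "norm x = 1 \<Longrightarrow> norm y = 1 \<Longrightarrow> \<bar>x \<bullet> y\<bar> \<le> 1"
  for x y :: "'a::real_inner"
  using Cauchy_Schwarz_ineq2[of x y] by simp

lemma abs_inner_eq_one_iff:
  assumes "norm x = 1" "norm y = 1"
  shows "\<bar>x \<bullet> y\<bar> = 1 \<longleftrightarrow> pm x = pm y"
  using assms norm_cauchy_schwarz_abs_eq[of x y] by (auto simp: pm_eq_iff)

lemma norm_reject_sq:
  assumes "norm x = 1" "norm y = 1"
  shows "(norm (y - (x \<bullet> y) *\<^sub>R x))\<^sup>2 = 1 - (x \<bullet> y)\<^sup>2"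
  using assms unfolding power2_norm_eq_inner
  by (simp add: inner_diff_left inner_diff_right inner_commute power2_eq_square norm_eq_1)

lemma sph_proj_range:
  assumes "norm x = 1" "norm y = 1" "pm y \<noteq> pm x"
  obtains z where "norm z = 1" "x \<bullet> z = 0" "sph_proj (pm x) (pm y) = pm z"
proof
  let ?w = "y - (x \<bullet> y) *\<^sub>R x"
  have "\<bar>x \<bullet> y\<bar> < 1"
    using assms abs_inner_eq_one_iff[of x y] abs_inner_le_one[of x y] by force
  then have pos: "1 - (x \<bullet> y)\<^sup>2 > 0"
    by (simp add: abs_square_less_1)
  have "norm ?w = sqrt (1 - (x \<bullet> y)\<^sup>2)"
    by (rule real_sqrt_unique[symmetric]) (use assms norm_reject_sq[of x y] in auto)
  then show "norm (?w /\<^sub>R sqrt (1 - (x \<bullet> y)\<^sup>2)) = 1"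
    using pos by simp
  show "x \<bullet> (?w /\<^sub>R sqrt (1 - (x \<bullet> y)\<^sup>2)) = 0"
    using assms by (simp add: inner_diff_right norm_eq_1)
qed (rule sph_proj_pm)

lemma inner_ge_cos_add:
  assumes "norm x = 1" "norm y = 1" "norm z = 1"
  shows "x \<bullet> z \<ge> (x \<bullet> y) * (y \<bullet> z) - sqrt (1 - (x \<bullet> y)\<^sup>2) * sqrt (1 - (y \<bullet> z)\<^sup>2)"
proof -
  let ?u = "x - (y \<bullet> x) *\<^sub>R y" and ?v = "z - (y \<bullet> z) *\<^sub>R y"
  have "norm ?u = sqrt (1 - (x \<bullet> y)\<^sup>2)" "norm ?v = sqrt (1 - (y \<bullet> z)\<^sup>2)"
    using norm_reject_sq[of y x] norm_reject_sq[of y z] assms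
    by (auto intro!: real_sqrt_unique[symmetric] simp: inner_commute)
  moreover have "?u \<bullet> ?v = x \<bullet> z - (x \<bullet> y) * (y \<bullet> z)"
    using assms by (simp add: inner_diff_left inner_diff_right norm_eq_1 inner_commute)
  moreover have "- (norm ?u * norm ?v) \<le> ?u \<bullet> ?v"
    using Cauchy_Schwarz_ineq2[of ?u ?v] by linarith
  ultimately show ?thesis by simp
qed

lemma Metric_space_proj: "Metric_space (proj_space :: 'a::real_inner set set) rho"
proof
  fix P Q R :: "'a set"
  show "0 \<le> rho P Q"
  proof (cases "P \<in> proj_space \<and> Q \<in> proj_space")
    case True
    then obtain x y where "norm x = 1" "P = pm x" "norm y = 1" "Q = pm y"
      by (metis proj_space_cases)
    moreover from this have "\<bar>x \<bullet> y\<bar> \<le> 1"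
      by (intro abs_inner_le_one)
    ultimately show ?thesis
      by (simp add: rho_pm arccos_lbound)
  qed (auto simp: rho_def)
  show "rho P Q = rho Q P"
    by (simp add: rho_def abs_inner_def inner_commute)
  show "rho P Q = 0 \<longleftrightarrow> P = Q" if "P \<in> proj_space" "Q \<in> proj_space"
  proof -
    obtain x y where xy: "norm x = 1" "P = pm x" "norm y = 1" "Q = pm y"
      using \<open>P \<in> proj_space\<close> \<open>Q \<in> proj_space\<close> by (metis proj_space_cases)
    have "arccos \<bar>x \<bullet> y\<bar> = 0 \<longleftrightarrow> \<bar>x \<bullet> y\<bar> = 1"
    proof
      assume "arccos \<bar>x \<bullet> y\<bar> = 0"
      moreover have "cos (arccos \<bar>x \<bullet> y\<bar>) = \<bar>x \<bullet> y\<bar>"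
        using abs_inner_le_one[OF xy(1,3)] by (intro cos_arccos) linarith+
      ultimately show "\<bar>x \<bullet> y\<bar> = 1" by simp
    qed simp
    then show ?thesis
      using xy abs_inner_eq_one_iff[of x y] by (simp add: rho_pm)
  qed
  show "rho P R \<le> rho P Q + rho Q R"
    if PQR: "P \<in> proj_space" "Q \<in> proj_space" "R \<in> proj_space"
  proof -
    obtain x0 y z0 where 0: "norm x0 = 1" "P = pm x0" "norm y = 1" "Q = pm y"
        "norm z0 = 1" "R = pm z0"
      using PQR by (metis proj_space_cases)
    define x where "x = (if x0 \<bullet> y \<ge> 0 then x0 else - x0)"
    define z where "z = (if y \<bullet> z0 \<ge> 0 then z0 else - z0)"
    have n: "norm x = 1" "norm y = 1" "norm z = 1" "P = pm x" "Q = pm y" "R = pm z"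
      "x \<bullet> y \<ge> 0" "y \<bullet> z \<ge> 0"
      using 0 by (auto simp: x_def z_def)
    define a where "a = arccos (x \<bullet> y)"
    define b where "b = arccos (y \<bullet> z)"
    have le: "\<bar>x \<bullet> y\<bar> \<le> 1" "\<bar>y \<bullet> z\<bar> \<le> 1" "\<bar>x \<bullet> z\<bar> \<le> 1"
      using n abs_inner_le_one by blast+
    have ab: "0 \<le> a" "a \<le> pi/2" "0 \<le> b" "b \<le> pi/2"
      unfolding a_def b_def using le n(7,8)
      by (intro arccos_lbound arccos_le_pi2; linarith)+
    have "cos (a + b) = (x \<bullet> y) * (y \<bullet> z) - sqrt (1 - (x \<bullet> y)\<^sup>2) * sqrt (1 - (y \<bullet> z)\<^sup>2)"
      using le n by (simp add: cos_add a_def b_def sin_arccos_abs)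
    also have "\<dots> \<le> \<bar>x \<bullet> z\<bar>"
      using inner_ge_cos_add[of x y z] n by linarith
    finally have "arccos \<bar>x \<bullet> z\<bar> \<le> arccos (cos (a + b))"
      using le by (intro arccos_le_arccos) auto
    also have "\<dots> = a + b"
      using ab by (intro arccos_cos) auto
    finally show ?thesis
      using n by (simp add: rho_pm a_def b_def)
  qed
qed


section \<open>Existence of the helix\<close>

text \<open>In the Hilbert space of square-summable sequences the family
  \<open>h(t) = \<plusminus>(tanh(t)\<^sup>n / cosh(t))\<^bsub>n\<^esub>\<close> is a helix.\<close>

typedef ell2 = "{f :: nat \<Rightarrow> real. summable (\<lambda>n. (f n)\<^sup>2)}"
  morphisms ell2_nth Abs_ell2
  by (rule exI[of _ "\<lambda>_. 0"]) simp

setup_lifting type_definition_ell2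

lemma summable_mult_ell2:
  fixes f g :: "nat \<Rightarrow> real"
  assumes "summable (\<lambda>n. (f n)\<^sup>2)" "summable (\<lambda>n. (g n)\<^sup>2)"
  shows "summable (\<lambda>n. f n * g n)"
proof (rule summable_comparison_test')
  show "summable (\<lambda>n. (f n)\<^sup>2 + (g n)\<^sup>2)"
    using assms by (rule summable_add)
  show "norm (f n * g n) \<le> (f n)\<^sup>2 + (g n)\<^sup>2" if "n \<ge> 0" for n
  proof -
    have "2 * \<bar>f n\<bar> * \<bar>g n\<bar> \<le> \<bar>f n\<bar>\<^sup>2 + \<bar>g n\<bar>\<^sup>2"
      by (rule sum_squares_bound)
    moreover have "0 \<le> \<bar>f n\<bar> * \<bar>g n\<bar>" by simp
    ultimately show ?thesis
      unfolding power2_abs real_norm_def abs_mult by linarith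
  qed
qed

lemma summable_add_ell2:
  fixes f g :: "nat \<Rightarrow> real"
  assumes "summable (\<lambda>n. (f n)\<^sup>2)" "summable (\<lambda>n. (g n)\<^sup>2)"
  shows "summable (\<lambda>n. (f n + g n)\<^sup>2)"
proof -
  have "summable (\<lambda>n. (f n)\<^sup>2 + (g n)\<^sup>2 + 2 * (f n * g n))"
    by (intro summable_add summable_mult assms summable_mult_ell2)
  then show ?thesis
    by (simp add: power2_sum mult.assoc)
qed

lemma summable_ell2_nth_sq: "summable (\<lambda>n. (ell2_nth x n)\<^sup>2)"
  using ell2_nth[of x] by simp

lemma summable_ell2_nth_mult: "summable (\<lambda>n. ell2_nth x n * ell2_nth y n)"
  by (intro summable_mult_ell2 summable_ell2_nth_sq)

instantiation ell2 :: real_vector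
begin

lift_definition zero_ell2 :: ell2 is "\<lambda>_. 0" by simp
lift_definition uminus_ell2 :: "ell2 \<Rightarrow> ell2" is "\<lambda>f n. - f n" by simp
lift_definition plus_ell2 :: "ell2 \<Rightarrow> ell2 \<Rightarrow> ell2" is "\<lambda>f g n. f n + g n"
  by (rule summable_add_ell2)
lift_definition minus_ell2 :: "ell2 \<Rightarrow> ell2 \<Rightarrow> ell2" is "\<lambda>f g n. f n - g n"
  subgoal for f g using summable_add_ell2[of f "\<lambda>n. - g n"] by simp
  done
lift_definition scaleR_ell2 :: "real \<Rightarrow> ell2 \<Rightarrow> ell2" is "\<lambda>c f n. c * f n"
  by (simp add: power_mult_distrib summable_mult)

instance
  by standard (transfer; simp add: algebra_simps fun_eq_iff)+

end

lemmas ell2_nth_simps [simp] =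
  zero_ell2.rep_eq uminus_ell2.rep_eq plus_ell2.rep_eq minus_ell2.rep_eq scaleR_ell2.rep_eq

instantiation ell2 :: real_inner
begin

definition inner_ell2 :: "ell2 \<Rightarrow> ell2 \<Rightarrow> real" where
  "inner_ell2 x y = (\<Sum>n. ell2_nth x n * ell2_nth y n)"
definition norm_ell2 :: "ell2 \<Rightarrow> real" where "norm_ell2 x = sqrt (inner x x)"
definition dist_ell2 :: "ell2 \<Rightarrow> ell2 \<Rightarrow> real" where "dist_ell2 x y = norm (x - y)"
definition sgn_ell2 :: "ell2 \<Rightarrow> ell2" where "sgn_ell2 x = x /\<^sub>R norm x"
definition uniformity_ell2 :: "(ell2 \<times> ell2) filter" where
  "uniformity_ell2 = (INF e\<in>{0<..}. principal {(x, y). dist x y < e})"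
definition open_ell2 :: "ell2 set \<Rightarrow> bool" where
  "open_ell2 U = (\<forall>x\<in>U. \<forall>\<^sub>F (x', y) in uniformity. x' = x \<longrightarrow> y \<in> U)"

instance
proof
  fix x y z :: ell2 and r :: real
  show "inner x y = inner y x"
    by (simp add: inner_ell2_def mult.commute)
  show "inner (x + y) z = inner x z + inner y z"
    by (simp add: inner_ell2_def distrib_right suminf_add summable_ell2_nth_mult)
  show "inner (r *\<^sub>R x) y = r * inner x y"
    by (simp add: inner_ell2_def mult.assoc suminf_mult summable_ell2_nth_mult)
  show "0 \<le> inner x x"
    unfolding inner_ell2_def by (intro suminf_nonneg summable_ell2_nth_mult) simp
  show "inner x x = 0 \<longleftrightarrow> x = 0"
    unfolding inner_ell2_def
    by (subst suminf_eq_zero_iff[OF summable_ell2_nth_mult])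
      (auto simp: ell2_nth_inject[symmetric] fun_eq_iff)
qed (fact dist_ell2_def sgn_ell2_def uniformity_ell2_def open_ell2_def norm_ell2_def)+

end

lemma norm_ell2_sq: "(norm x)\<^sup>2 = (\<Sum>n. (ell2_nth x n)\<^sup>2)"
  unfolding power2_norm_eq_inner inner_ell2_def by (simp add: power2_eq_square)

lemma sum_le_norm_ell2_sq: "(\<Sum>i<k. (ell2_nth x i)\<^sup>2) \<le> (norm x)\<^sup>2"
  unfolding norm_ell2_sq by (intro sum_le_suminf summable_ell2_nth_sq) auto

lemma abs_ell2_nth_le_norm: "\<bar>ell2_nth x i\<bar> \<le> norm x"
proof (rule power2_le_imp_le)
  have "(ell2_nth x i)\<^sup>2 \<le> (\<Sum>j<Suc i. (ell2_nth x j)\<^sup>2)"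
    by (simp add: sum_nonneg)
  then show "\<bar>ell2_nth x i\<bar>\<^sup>2 \<le> (norm x)\<^sup>2"
    using sum_le_norm_ell2_sq[where k = "Suc i" and x = x] by simp
qed simp

instance ell2 :: complete_space
proof
  fix X :: "nat \<Rightarrow> ell2"
  assume X: "Cauchy X"
  have "Cauchy (\<lambda>n. ell2_nth (X n) i)" for i
  proof (rule metric_CauchyI)
    fix e :: real assume "e > 0"
    then obtain N where N: "\<And>m n. m \<ge> N \<Longrightarrow> n \<ge> N \<Longrightarrow> dist (X m) (X n) < e"
      using metric_CauchyD[OF X] by blast
    have "dist (ell2_nth (X m) i) (ell2_nth (X n) i) < e" if "m \<ge> N" "n \<ge> N" for m n
      using abs_ell2_nth_le_norm[of "X m - X n" i] N[OF that] by (simp add: dist_norm)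
    then show "\<exists>N. \<forall>m\<ge>N. \<forall>n\<ge>N. dist (ell2_nth (X m) i) (ell2_nth (X n) i) < e"
      by blast
  qed
  then have "\<forall>i. \<exists>a. (\<lambda>n. ell2_nth (X n) i) \<longlonglongrightarrow> a"
    unfolding Cauchy_convergent_iff convergent_def by blast
  from choice[OF this] obtain l where l: "\<And>i. (\<lambda>n. ell2_nth (X n) i) \<longlonglongrightarrow> l i"
    by blast
  have key: "\<exists>N. \<forall>m\<ge>N. \<forall>k. (\<Sum>i<k. (ell2_nth (X m) i - l i)\<^sup>2) \<le> e\<^sup>2" if "e > 0" for e :: real
  proof -
    obtain N where N: "\<And>m n. m \<ge> N \<Longrightarrow> n \<ge> N \<Longrightarrow> dist (X m) (X n) < e"
      using metric_CauchyD[OF X \<open>e > 0\<close>] by blast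
    have "(\<Sum>i<k. (ell2_nth (X m) i - l i)\<^sup>2) \<le> e\<^sup>2" if "m \<ge> N" for m k
    proof (rule LIMSEQ_le_const2)
      show "(\<lambda>n. \<Sum>i<k. (ell2_nth (X m) i - ell2_nth (X n) i)\<^sup>2)
          \<longlonglongrightarrow> (\<Sum>i<k. (ell2_nth (X m) i - l i)\<^sup>2)"
        by (intro tendsto_intros l)
      have "(\<Sum>i<k. (ell2_nth (X m) i - ell2_nth (X n) i)\<^sup>2) \<le> e\<^sup>2" if "n \<ge> N" for n
      proof -
        have "(\<Sum>i<k. (ell2_nth (X m) i - ell2_nth (X n) i)\<^sup>2) \<le> (norm (X m - X n))\<^sup>2"
          using sum_le_norm_ell2_sq[where k = k and x = "X m - X n"] by simp
        also have "\<dots> \<le> e\<^sup>2"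
          using N[OF \<open>m \<ge> N\<close> \<open>n \<ge> N\<close>] by (intro power_mono) (auto simp: dist_norm)
        finally show ?thesis .
      qed
      then show "\<exists>N. \<forall>n\<ge>N. (\<Sum>i<k. (ell2_nth (X m) i - ell2_nth (X n) i)\<^sup>2) \<le> e\<^sup>2"
        by blast
    qed
    then show ?thesis by blast
  qed
  have summ: "summable (\<lambda>i. (ell2_nth (X m) i - l i)\<^sup>2)"
    if "\<forall>k. (\<Sum>i<k. (ell2_nth (X m) i - l i)\<^sup>2) \<le> c" for m c
    using that by (intro summableI_nonneg_bounded[of _ c]) auto
  obtain N where "\<forall>m\<ge>N. \<forall>k. (\<Sum>i<k. (ell2_nth (X m) i - l i)\<^sup>2) \<le> 1\<^sup>2"
    using key[of 1] by auto
  then have "summable (\<lambda>i. (ell2_nth (X N) i - l i)\<^sup>2)"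
    by (intro summ[of _ "1\<^sup>2"]) auto
  then have "summable (\<lambda>i. (ell2_nth (X N) i + - (ell2_nth (X N) i - l i))\<^sup>2)"
    by (intro summable_add_ell2 summable_ell2_nth_sq) (simp only: power2_minus)
  then have "summable (\<lambda>i. (l i)\<^sup>2)" by simp
  then have L: "ell2_nth (Abs_ell2 l) = l"
    by (intro Abs_ell2_inverse) simp
  have "X \<longlonglongrightarrow> Abs_ell2 l"
  proof (rule metric_LIMSEQ_I)
    fix e :: real assume "e > 0"
    then obtain N where N: "\<forall>m\<ge>N. \<forall>k. (\<Sum>i<k. (ell2_nth (X m) i - l i)\<^sup>2) \<le> (e/2)\<^sup>2"
      using key[of "e/2"] by auto
    have "dist (X m) (Abs_ell2 l) < e" if "m \<ge> N" for m
    proof -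
      have "(norm (X m - Abs_ell2 l))\<^sup>2 \<le> (e/2)\<^sup>2"
        unfolding norm_ell2_sq using N that L
        by (auto intro!: suminf_le_const summ)
      then have "norm (X m - Abs_ell2 l) \<le> e/2"
        by (rule power2_le_imp_le) (use \<open>e > 0\<close> in simp)
      then show ?thesis
        using \<open>e > 0\<close> by (simp add: dist_norm)
    qed
    then show "\<exists>N. \<forall>m\<ge>N. dist (X m) (Abs_ell2 l) < e" by blast
  qed
  then show "convergent X" by (auto simp: convergent_def)
qed

lemma ell2_infinite_dimensional: "\<nexists>B. finite B \<and> span B = (UNIV :: ell2 set)"
proof
  assume "\<exists>B. finite B \<and> span B = (UNIV :: ell2 set)"
  then obtain B where B: "finite B" "span B = (UNIV :: ell2 set)" by blast
  define e where "e m = Abs_ell2 (\<lambda>n. if n = m then 1 else 0)" for m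
  have "summable (\<lambda>n. (if n = m then 1 else 0 :: real)\<^sup>2)" for m
    by (rule summable_finite[of "{m}"]) auto
  then have e: "ell2_nth (e m) = (\<lambda>n. if n = m then 1 else 0)" for m
    unfolding e_def by (intro Abs_ell2_inverse) simp
  have inj: "inj e"
  proof (rule injI)
    fix m n assume "e m = e n"
    then have "ell2_nth (e m) m = ell2_nth (e n) m" by simp
    then show "m = n" by (simp add: e split: if_splits)
  qed
  have "e m \<bullet> e n = 0" if "m \<noteq> n" for m n
  proof -
    have "(\<lambda>k. ell2_nth (e m) k * ell2_nth (e n) k) = (\<lambda>_. 0)"
      using that by (auto simp: e)
    then show ?thesis by (simp add: inner_ell2_def)
  qed
  then have "pairwise orthogonal (range e)"
    unfolding pairwise_image by (simp add: pairwise_def orthogonal_def)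
  moreover have "0 \<notin> range e"
  proof
    assume "0 \<in> range e"
    then obtain m where "0 = e m" by blast
    then have "ell2_nth 0 m = ell2_nth (e m) m" by simp
    then show False by (simp add: e)
  qed
  ultimately have "independent (range e)"
    by (rule pairwise_orthogonal_independent)
  then have "finite (range e)"
    using independent_span_bound[OF B(1), of "range e"] B(2) by auto
  then show False
    using inj finite_imageD[of e UNIV] infinite_UNIV_nat by blast
qed

theorem helix_exists: "\<exists>h :: real \<Rightarrow> ell2 set. helix h"
proof -
  define v where "v t = Abs_ell2 (\<lambda>n. tanh t ^ n / cosh t)" for t :: real
  have less: "\<bar>tanh s * tanh t\<bar> < 1" for s t :: real
  proof -
    have "\<bar>tanh s\<bar> < 1" "\<bar>tanh t\<bar> < 1"
      using tanh_real_bounds[of s] tanh_real_bounds[of t] by auto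
    then have "\<bar>tanh s\<bar> * \<bar>tanh t\<bar> < 1 * 1"
      by (intro mult_strict_mono') auto
    then show ?thesis by (simp add: abs_mult)
  qed
  have sums: "(\<lambda>n. (tanh s ^ n / cosh s) * (tanh t ^ n / cosh t)) sums (1 / cosh (t - s))"
    for s t :: real
  proof -
    have "(\<lambda>n. (tanh s * tanh t) ^ n / (cosh s * cosh t)) sums
        ((1 / (1 - tanh s * tanh t)) / (cosh s * cosh t))"
      using less[of s t] by (intro sums_divide geometric_sums) simp
    moreover have "(1 - tanh s * tanh t) * (cosh s * cosh t) = cosh (t - s)"
      by (simp add: cosh_diff tanh_def field_simps)
    ultimately show ?thesis
      by (simp add: power_mult_distrib)
  qed
  have "summable (\<lambda>n. (tanh t ^ n / cosh t)\<^sup>2)" for t :: real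
    using sums_summable[OF sums[of t t]] by (simp add: power2_eq_square)
  then have v: "ell2_nth (v t) = (\<lambda>n. tanh t ^ n / cosh t)" for t
    unfolding v_def by (intro Abs_ell2_inverse) simp
  have inner: "v s \<bullet> v t = 1 / cosh (t - s)" for s t
    unfolding inner_ell2_def v using sums_unique[OF sums[of s t]] by simp
  have "helix (\<lambda>t. pm (v t))"
    unfolding helix_def using ell2_infinite_dimensional
    by (auto simp: abs_inner_pm inner norm_eq_1 intro!: pm_in_proj_space)
  then show ?thesis by blast
qed

end

theory Submission
  imports Defs
begin

text \<open>
  For unit vectors \<open>x\<close>, \<open>y\<close>, \<open>z\<close> the condition that the projection from \<open>\<plusminus>x\<close> preserves the
  distance of \<open>\<plusminus>y\<close> and \<open>\<plusminus>z\<close> turns out to be symmetric in the three points.  It shows that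
  non-orthogonality is transitive, so that by connectedness no two points of the curve are
  orthogonal, and in terms of \<open>d = arcosh (1 / \<bar>\<langle>\<cdot>,\<cdot>\<rangle>\<bar>)\<close> it says that one of the three distances is
  the sum of the two others.  On a continuous injective curve the largest distance of such a
  triple must be that of the outer two points; hence \<open>d\<close> is additive along the curve, and the
  signed distance \<open>u(t)\<close> from \<open>\<gamma>(0)\<close> gives the isometry \<open>\<gamma>(t) \<mapsto> h(u(t))\<close>.
\<close>

section \<open>Triples of points\<close>

lemma abs_inner_bounds:
  assumes "P \<in> proj_space" "Q \<in> proj_space"
  shows "0 \<le> abs_inner P Q" "abs_inner P Q \<le> 1"
proof -
  obtain x y where "norm x = 1" "P = pm x" "norm y = 1" "Q = pm y"
    using assms by (metis proj_space_cases)
  then show "0 \<le> abs_inner P Q" "abs_inner P Q \<le> 1"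
    using abs_inner_le_one by (auto simp: abs_inner_pm)
qed

lemma abs_inner_commute: "abs_inner P Q = abs_inner Q P"
  by (simp add: abs_inner_def inner_commute)

lemma abs_inner_proj_eq_one_iff:
  assumes "P \<in> proj_space" "Q \<in> proj_space"
  shows "abs_inner P Q = 1 \<longleftrightarrow> P = Q"
  using assms by (metis abs_inner_pm abs_inner_eq_one_iff proj_space_cases)

lemma cos_rho:
  assumes "P \<in> proj_space" "Q \<in> proj_space"
  shows "cos (rho P Q) = abs_inner P Q"
  using abs_inner_bounds[OF assms] assms by (simp add: rho_def)

text \<open>Before normalization the two projections have inner product
  \<open>y \<bullet> z - (x \<bullet> y) * (x \<bullet> z)\<close>. Comparing the cosines of the two
  distances and squaring removes the absolute values and the normalizing roots.\<close>

lemma projection_identity: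
  assumes n: "norm x = 1" "norm y = 1" "norm z = 1"
    and ne: "pm y \<noteq> pm x" "pm z \<noteq> pm x"
    and eq: "rho (sph_proj (pm x) (pm y)) (sph_proj (pm x) (pm z)) = rho (pm y) (pm z)"
  shows "(y \<bullet> z - (x \<bullet> y) * (x \<bullet> z))\<^sup>2 = (y \<bullet> z)\<^sup>2 * ((1 - (x \<bullet> y)\<^sup>2) * (1 - (x \<bullet> z)\<^sup>2))"
proof -
  let ?p = "x \<bullet> y" and ?q = "x \<bullet> z" and ?r = "y \<bullet> z"
  \<comment> \<open>Both points differ from the centre, so the normalizing roots are
    nonzero.\<close>
  have "\<bar>?p\<bar> < 1" "\<bar>?q\<bar> < 1"
    using n ne abs_inner_eq_one_iff[of x y] abs_inner_le_one[of x y]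
      abs_inner_eq_one_iff[of x z] abs_inner_le_one[of x z] by force+
  then have pos: "1 - ?p\<^sup>2 > 0" "1 - ?q\<^sup>2 > 0"
    by (simp_all add: abs_square_less_1)
  have sp: "sph_proj (pm x) (pm y) \<in> proj_space" "sph_proj (pm x) (pm z) \<in> proj_space"
    using sph_proj_range n ne by (metis pm_in_proj_space)+
  have "abs_inner (sph_proj (pm x) (pm y)) (sph_proj (pm x) (pm z)) = abs_inner (pm y) (pm z)"
    using eq cos_rho[OF sp] cos_rho[of "pm y" "pm z"] n by (simp add: pm_in_proj_space)
  moreover have "(y - ?p *\<^sub>R x) \<bullet> (z - ?q *\<^sub>R x) = ?r - ?p * ?q"
    using n by (simp add: inner_diff_left inner_diff_right norm_eq_1 inner_commute)
  ultimately have "\<bar>?r - ?p * ?q\<bar> / (sqrt (1 - ?p\<^sup>2) * sqrt (1 - ?q\<^sup>2)) = \<bar>?r\<bar>"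
    using pos by (simp add: sph_proj_pm abs_inner_pm abs_mult divide_simps)
  then have "\<bar>?r - ?p * ?q\<bar> = \<bar>?r\<bar> * sqrt ((1 - ?p\<^sup>2) * (1 - ?q\<^sup>2))"
    using pos unfolding real_sqrt_mult by (simp add: divide_simps)
  then have "\<bar>?r - ?p * ?q\<bar>\<^sup>2 = (\<bar>?r\<bar> * sqrt ((1 - ?p\<^sup>2) * (1 - ?q\<^sup>2)))\<^sup>2"
    by simp
  then show ?thesis
    using pos by (simp add: power_mult_distrib)
qed

lemma triple_identity:
  fixes p q r :: real
  assumes "(r - p * q)\<^sup>2 = r\<^sup>2 * ((1 - p\<^sup>2) * (1 - q\<^sup>2))" and "\<bar>p\<bar> \<le> 1"
  shows "\<bar>p\<bar>\<^sup>2 * \<bar>q\<bar>\<^sup>2 + \<bar>q\<bar>\<^sup>2 * \<bar>r\<bar>\<^sup>2 + \<bar>r\<bar>\<^sup>2 * \<bar>p\<bar>\<^sup>2 - \<bar>p\<bar>\<^sup>2 * \<bar>q\<bar>\<^sup>2 * \<bar>r\<bar>\<^sup>2 = 2 * (\<bar>p\<bar> * \<bar>q\<bar> * \<bar>r\<bar>)"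
proof -
  have eq: "p\<^sup>2 * q\<^sup>2 + q\<^sup>2 * r\<^sup>2 + r\<^sup>2 * p\<^sup>2 - p\<^sup>2 * q\<^sup>2 * r\<^sup>2 = 2 * (p * q * r)"
    using assms(1) by (simp add: power2_eq_square algebra_simps)
  \<comment> \<open>The only negative term on the left of \<open>eq\<close> is absorbed by the term
    in \<open>q\<close> and \<open>r\<close>.\<close>
  have "p\<^sup>2 * (q\<^sup>2 * r\<^sup>2) \<le> 1 * (q\<^sup>2 * r\<^sup>2)"
    using assms(2) by (intro mult_right_mono) (auto simp: abs_square_le_1)
  moreover have "0 \<le> p\<^sup>2 * q\<^sup>2" "0 \<le> r\<^sup>2 * p\<^sup>2"
    by auto
  ultimately have "0 \<le> p * q * r"
    using eq unfolding mult_1 mult.assoc by linarith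
  then have "p * q * r = \<bar>p\<bar> * \<bar>q\<bar> * \<bar>r\<bar>"
    by (simp add: abs_mult[symmetric])
  then show ?thesis
    using eq by simp
qed

text \<open>The case \<open>Q = R\<close> is included; the transitivity argument for
  non-orthogonality relies on this.\<close>

lemma unchanged_triple_identity:
  assumes "isometry_type_unchanged S" "S \<subseteq> proj_space"
    and "P \<in> S" "Q \<in> S" "R \<in> S" "Q \<noteq> P" "R \<noteq> P"
    and "p = abs_inner P Q" "q = abs_inner P R" "r = abs_inner Q R"
  shows "p\<^sup>2 * q\<^sup>2 + q\<^sup>2 * r\<^sup>2 + r\<^sup>2 * p\<^sup>2 - p\<^sup>2 * q\<^sup>2 * r\<^sup>2 = 2 * (p * q * r)"
proof -
  have "P \<in> proj_space" "Q \<in> proj_space" "R \<in> proj_space"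
    using assms by auto
  then obtain x y z where xyz: "norm x = 1" "P = pm x" "norm y = 1" "Q = pm y"
      "norm z = 1" "R = pm z"
    by (metis proj_space_cases)
  have "rho (sph_proj P Q) (sph_proj P R) = rho Q R"
    using assms(1,3-7) by (auto simp: isometry_type_unchanged_def)
  then show ?thesis
    using triple_identity[OF projection_identity[of x y z]] abs_inner_le_one[of x y] xyz assms(6-)
    by (simp add: abs_inner_pm)
qed

text \<open>Read as a quadratic equation in \<open>cosh c\<close>, the hypothesis has the roots
  \<open>cosh (a + b)\<close> and \<open>cosh (a - b)\<close>. Since \<open>cosh\<close> determines
  its argument up to sign, \<open>c\<close> is \<open>a + b\<close> or
  \<open>\<bar>a - b\<bar>\<close>.\<close>

lemma cosh_triple_degenerate:
  fixes a b c :: real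
  assumes "(cosh a)\<^sup>2 + (cosh b)\<^sup>2 + (cosh c)\<^sup>2 - 1 = 2 * (cosh a * cosh b * cosh c)"
    and "a \<ge> 0" "b \<ge> 0" "c \<ge> 0"
  shows "c = a + b \<or> a = b + c \<or> b = a + c"
proof -
  have "cosh (a + b) + cosh (a - b) = 2 * (cosh a * cosh b)"
    by (simp add: cosh_add cosh_diff)
  moreover have "cosh (a + b) * cosh (a - b) = (cosh a)\<^sup>2 + (cosh b)\<^sup>2 - 1"
  proof -
    have "cosh (a + b) * cosh (a - b) = (cosh a)\<^sup>2 * (cosh b)\<^sup>2 - (sinh a)\<^sup>2 * (sinh b)\<^sup>2"
      by (simp add: cosh_add cosh_diff power2_eq_square algebra_simps)
    then show ?thesis
      by (simp add: sinh_square_eq algebra_simps)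
  qed
  moreover have "(cosh c - cosh (a + b)) * (cosh c - cosh (a - b)) =
      (cosh c)\<^sup>2 - cosh c * (cosh (a + b) + cosh (a - b)) + cosh (a + b) * cosh (a - b)"
    by (simp add: power2_eq_square algebra_simps)
  ultimately have "(cosh c - cosh (a + b)) * (cosh c - cosh (a - b)) = 0"
    using assms(1) by (simp add: algebra_simps)
  then have "\<bar>c\<bar> = \<bar>a + b\<bar> \<or> \<bar>c\<bar> = \<bar>a - b\<bar>"
    by simp
  then show ?thesis
    using assms(2-) by linarith
qed

text \<open>Division by the product of the three squares turns the identity into the hyperbolic one
  for the reciprocals \<open>1 / p\<close>, \<open>1 / q\<close>, \<open>1 / r\<close>.\<close>

lemma arcosh_triple_degenerate:
  fixes p q r :: real
  assumes "p\<^sup>2 * q\<^sup>2 + q\<^sup>2 * r\<^sup>2 + r\<^sup>2 * p\<^sup>2 - p\<^sup>2 * q\<^sup>2 * r\<^sup>2 = 2 * (p * q * r)"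
    and pos: "0 < p" "p \<le> 1" "0 < q" "q \<le> 1" "0 < r" "r \<le> 1"
  defines "a \<equiv> arcosh (1 / p)" and "b \<equiv> arcosh (1 / q)" and "c \<equiv> arcosh (1 / r)"
  shows "c = a + b \<or> a = b + c \<or> b = a + c"
proof (rule cosh_triple_degenerate)
  have ge: "1 / p \<ge> 1" "1 / q \<ge> 1" "1 / r \<ge> 1"
    using pos by auto
  then show "a \<ge> 0" "b \<ge> 0" "c \<ge> 0"
    by (simp_all only: a_def b_def c_def arcosh_nonneg_real)
  have cosh: "cosh a = 1 / p" "cosh b = 1 / q" "cosh c = 1 / r"
    using ge by (simp_all only: a_def b_def c_def cosh_arcosh_real)
  have "(1 / p)\<^sup>2 + (1 / q)\<^sup>2 + (1 / r)\<^sup>2 - 1 =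
      (p\<^sup>2 * q\<^sup>2 + q\<^sup>2 * r\<^sup>2 + r\<^sup>2 * p\<^sup>2 - p\<^sup>2 * q\<^sup>2 * r\<^sup>2) / (p\<^sup>2 * q\<^sup>2 * r\<^sup>2)"
    using pos by (simp add: field_simps)
  also have "\<dots> = 2 * (1 / p * (1 / q) * (1 / r))"
    unfolding assms(1) using pos by (simp add: power2_eq_square)
  finally show "(cosh a)\<^sup>2 + (cosh b)\<^sup>2 + (cosh c)\<^sup>2 - 1 = 2 * (cosh a * cosh b * cosh c)"
    unfolding cosh .
qed

section \<open>Degenerate metrics on the line\<close>

text \<open>The ordered triples form a connected set, and each of the three alternatives is a closed
  condition. Positivity makes them mutually exclusive, so a single one holds for all triples. The
  two unwanted ones fail when two of the points merge.\<close>

lemma degenerate_metric_additive: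
  fixes d :: "real \<Rightarrow> real \<Rightarrow> real"
  assumes cont: "continuous_on UNIV (\<lambda>(s, t). d s t)"
    and zero: "\<And>t. d t t = 0"
    and pos: "\<And>s t. s < t \<Longrightarrow> d s t > 0"
    and deg: "\<And>a b c. a < b \<Longrightarrow> b < c \<Longrightarrow>
      d b c = d a b + d a c \<or> d a b = d a c + d b c \<or> d a c = d a b + d b c"
    and less: "a < b" "b < c"
  shows "d a c = d a b + d b c"
proof -
  define X :: "(real \<times> real \<times> real) set" where "X = {(a, b, c). a < b \<and> b < c}"
  define A1 where "A1 = {(a, b, c). d b c = d a b + d a c}"
  define A2 where "A2 = {(a, b, c). d a b = d a c + d b c}"
  define A3 where "A3 = {(a, b, c). d a c = d a b + d b c}"
  have [continuous_intros]: "continuous_on S (\<lambda>x. d (f x) (g x))"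
    if "continuous_on S f" "continuous_on S g" for S f and g :: "'z::topological_space \<Rightarrow> real"
    using continuous_on_compose2[OF cont continuous_on_Pair[OF that]] by simp
  have closed: "closed A1" "closed A2" "closed A3"
    unfolding A1_def A2_def A3_def case_prod_unfold
    by (intro closed_Collect_eq continuous_intros)+
  \<comment> \<open>An intersection of two open half-spaces is convex, hence connected.\<close>
  have "X = (\<lambda>x. fst (snd x) - fst x) -` {0<..} \<inter> (\<lambda>x. snd (snd x) - fst (snd x)) -` {0<..}"
    by (auto simp: X_def)
  moreover have "convex ((\<lambda>x :: real \<times> real \<times> real. fst (snd x) - fst x) -` {0<..})"
      "convex ((\<lambda>x :: real \<times> real \<times> real. snd (snd x) - fst (snd x)) -` {0<..})"
    by (intro convex_linear_vimage linearI; simp add: algebra_simps)+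
  ultimately have "connected X"
    by (intro convex_connected) (simp add: convex_Int)
  have cover: "X \<subseteq> A1 \<union> A2 \<union> A3"
    using deg by (auto simp: X_def A1_def A2_def A3_def)
  have disj: "A1 \<inter> A2 \<inter> X = {}" "A1 \<inter> A3 \<inter> X = {}" "A2 \<inter> A3 \<inter> X = {}"
  proof -
    have "(a, b, c) \<notin> A1 \<inter> A2 \<and> (a, b, c) \<notin> A1 \<inter> A3 \<and> (a, b, c) \<notin> A2 \<inter> A3"
      if "(a, b, c) \<in> X" for a b c
    proof -
      have "d a b > 0" "d b c > 0" "d a c > 0"
        using that pos[of a b] pos[of b c] pos[of a c] by (auto simp: X_def)
      then show ?thesis
        unfolding A1_def A2_def A3_def Int_iff mem_Collect_eq prod.case by linarith
    qed
    then show "A1 \<inter> A2 \<inter> X = {}" "A1 \<inter> A3 \<inter> X = {}" "A2 \<inter> A3 \<inter> X = {}"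
      by auto
  qed
  have "A1 \<inter> X = {} \<or> (A2 \<union> A3) \<inter> X = {}"
    using cover disj by (intro connected_closedD[OF \<open>connected X\<close>] closed closed_Un) auto
  moreover have "(A2 \<union> A3) \<inter> X \<noteq> {}"
  proof
    assume "(A2 \<union> A3) \<inter> X = {}"
    then have "X \<subseteq> A1"
      using cover by auto
    \<comment> \<open>Membership of \<open>(0, 1, c)\<close> in \<open>A1\<close> reads
      \<open>d 1 c = d 0 1 + d 0 c\<close>. Letting \<open>c\<close> decrease to 1 would make
      \<open>d 1 1\<close> positive.\<close>
    have "d 1 c \<ge> d 0 1" if "c > 1" for c
    proof -
      have "(0, 1, c) \<in> A1"
        using that \<open>X \<subseteq> A1\<close> by (auto simp: X_def)
      then show ?thesis
        using that pos[of 0 c] by (simp add: A1_def)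
    qed
    moreover have "((\<lambda>c. d 1 c) \<longlongrightarrow> d 1 1) (at_right 1)"
    proof -
      have "continuous_on UNIV (\<lambda>c. d 1 c)"
        by (intro continuous_intros)
      then show ?thesis
        by (simp add: continuous_on_def filterlim_at_split)
    qed
    ultimately have "d 1 1 \<ge> d 0 1"
      by (intro tendsto_lowerbound[of "\<lambda>c. d 1 c" _ "at_right 1"])
        (auto simp: eventually_at_filter)
    then show False
      using pos[of 0 1] zero by simp
  qed
  ultimately have "A1 \<inter> X = {}"
    by blast
  have "A2 \<inter> X = {} \<or> (A1 \<union> A3) \<inter> X = {}"
    using cover disj by (intro connected_closedD[OF \<open>connected X\<close>] closed closed_Un) auto
  moreover have "(A1 \<union> A3) \<inter> X \<noteq> {}"
  proof
    assume "(A1 \<union> A3) \<inter> X = {}"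
    then have "X \<subseteq> A2"
      using cover by auto
    \<comment> \<open>The mirror image: \<open>(a, 0, 1)\<close> in \<open>A2\<close> reads
      \<open>d a 0 = d a 1 + d 0 1\<close>, and \<open>a\<close> increases to 0.\<close>
    have "d a 0 \<ge> d 0 1" if "a < 0" for a
    proof -
      have "(a, 0, 1) \<in> A2"
        using that \<open>X \<subseteq> A2\<close> by (auto simp: X_def)
      then show ?thesis
        using that pos[of a 1] by (simp add: A2_def)
    qed
    moreover have "((\<lambda>a. d a 0) \<longlongrightarrow> d 0 0) (at_left 0)"
    proof -
      have "continuous_on UNIV (\<lambda>a. d a 0)"
        by (intro continuous_intros)
      then show ?thesis
        by (simp add: continuous_on_def filterlim_at_split)
    qed
    ultimately have "d 0 0 \<ge> d 0 1"
      by (intro tendsto_lowerbound[of "\<lambda>a. d a 0" _ "at_left 0"])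
        (auto simp: eventually_at_filter)
    then show False
      using pos[of 0 1] zero by simp
  qed
  ultimately have "A2 \<inter> X = {}"
    by blast
  with \<open>A1 \<inter> X = {}\<close> cover have "X \<subseteq> A3"
    by blast
  then show ?thesis
    using less by (auto simp: X_def A3_def)
qed

text \<open>Additivity along the line makes the signed distance from the parameter 0 a coordinate
  that realizes \<open>d\<close>.\<close>

lemma degenerate_metric_coordinate:
  fixes d :: "real \<Rightarrow> real \<Rightarrow> real"
  assumes cont: "continuous_on UNIV (\<lambda>(s, t). d s t)"
    and zero: "\<And>t. d t t = 0"
    and sym: "\<And>s t. d s t = d t s"
    and pos: "\<And>s t. s < t \<Longrightarrow> d s t > 0"
    and deg: "\<And>a b c. a < b \<Longrightarrow> b < c \<Longrightarrow>
      d b c = d a b + d a c \<or> d a b = d a c + d b c \<or> d a c = d a b + d b c"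
  obtains u where "continuous_on UNIV u" "inj u" "\<And>s t. d s t = \<bar>u s - u t\<bar>"
proof
  define u where "u t = (if t \<le> 0 then - d 0 t else d 0 t)" for t
  have add: "d a c = d a b + d b c" if "a \<le> b" "b \<le> c" for a b c
  proof (cases "a = b \<or> b = c")
    case True
    then show ?thesis
      using zero by fastforce
  next
    case False
    then have less: "a < b" "b < c"
      using that by simp_all
    show ?thesis
      by (rule degenerate_metric_additive[OF cont]) (fact zero pos deg less)+
  qed
  have nonneg: "d s t \<ge> 0" for s t
    using pos[of s t] pos[of t s] zero sym[of s t] by (cases s t rule: linorder_cases) auto
  have diff: "u t - u s = d s t" if "s \<le> t" for s t
  proof -
    consider "t \<le> 0" | "s \<le> 0" "0 < t" | "0 < s"
      by linarith
    then show ?thesis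
    proof cases
      case 1
      then show ?thesis
        using that add[of s t 0] sym[of s 0] sym[of t 0] by (simp add: u_def)
    next
      case 2
      then show ?thesis
        using add[of s 0 t] sym[of s 0] by (simp add: u_def)
    next
      case 3
      then show ?thesis
        using that add[of 0 s t] by (simp add: u_def)
    qed
  qed
  show eq: "d s t = \<bar>u s - u t\<bar>" for s t
    using diff[of s t] diff[of t s] nonneg[of s t] sym[of s t] by (cases "s \<le> t") auto
  show "inj u"
  proof (rule injI)
    fix s t assume "u s = u t"
    then have "d s t = 0" "d t s = 0"
      by (simp_all add: eq)
    then show "s = t"
      using pos[of s t] pos[of t s] by (cases s t rule: linorder_cases) auto
  qed
  have "continuous_on UNIV (\<lambda>t. d 0 t)"
    using continuous_on_compose2[OF cont, of UNIV "\<lambda>t. (0, t)"]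
    by (simp add: continuous_on_Pair continuous_on_const continuous_on_id)
  \<comment> \<open>The two branches agree at the common point 0 because
    \<open>d 0 0 = 0\<close>.\<close>
  then have "continuous_on ({..0} \<union> {0..}) u"
    unfolding u_def using zero
    by (intro continuous_on_cases) (auto intro!: continuous_intros intro: continuous_on_subset)
  moreover have "{..0} \<union> {0..} = (UNIV :: real set)"
    by auto
  ultimately show "continuous_on UNIV u"
    by simp
qed

section \<open>Curves in projective space\<close>

text \<open>A metric is jointly continuous, and \<open>abs_inner\<close> is the cosine of
  \<open>rho\<close>.\<close>

lemma continuous_on_abs_inner_curve:
  assumes "continuous_map euclideanreal proj_topology \<gamma>"
  shows "continuous_on UNIV (\<lambda>(s, t). abs_inner (\<gamma> s) (\<gamma> t))"
proof -
  interpret Metric_space "proj_space :: 'a set set" rho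
    by (rule Metric_space_proj)
  have \<gamma>: "\<gamma> t \<in> proj_space" for t
    using assms by (auto simp: continuous_map_def)
  have "continuous_map euclidean proj_topology (\<lambda>x. \<gamma> (f x))"
    if "continuous_on UNIV f" for f :: "real \<times> real \<Rightarrow> real"
    using continuous_map_compose[OF _ assms, of euclidean f] that by (simp add: comp_def)
  then have "continuous_map euclidean proj_topology (\<lambda>x :: real \<times> real. \<gamma> (fst x))"
      "continuous_map euclidean proj_topology (\<lambda>x :: real \<times> real. \<gamma> (snd x))"
    by (simp_all add: continuous_on_fst continuous_on_snd continuous_on_id)
  then have "continuous_map euclidean euclideanreal
      (\<lambda>x. mdist (metric (proj_space, rho)) (\<gamma> (fst x)) (\<gamma> (snd x)))"
    by (intro continuous_map_mdist) simp_all
  then have "continuous_on UNIV (\<lambda>x. rho (\<gamma> (fst x)) (\<gamma> (snd x)))"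
    by simp
  then have "continuous_on UNIV (\<lambda>x. cos (rho (\<gamma> (fst x)) (\<gamma> (snd x))))"
    by (rule continuous_on_cos)
  then show ?thesis
    by (simp add: cos_rho \<gamma> case_prod_unfold)
qed

text \<open>Non-orthogonality is a symmetric and transitive relation on the parameters that holds
  between each parameter and all nearby ones. On the connected line such a relation holds
  everywhere.\<close>

lemma unchanged_curve_not_orthogonal:
  assumes cont: "continuous_map euclideanreal proj_topology \<gamma>"
    and inj: "inj \<gamma>"
    and unch: "isometry_type_unchanged (range \<gamma>)"
  shows "abs_inner (\<gamma> s) (\<gamma> t) \<noteq> 0"
proof (rule connected_equivalence_relation[where R = "\<lambda>s t. abs_inner (\<gamma> s) (\<gamma> t) \<noteq> 0" and S = UNIV])
  interpret Metric_space "proj_space :: 'a set set" rho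
    by (rule Metric_space_proj)
  have \<gamma>: "\<gamma> t \<in> proj_space" for t
    using cont by (auto simp: continuous_map_def)
  show "abs_inner (\<gamma> c) (\<gamma> b) \<noteq> 0" if "abs_inner (\<gamma> b) (\<gamma> c) \<noteq> 0" for b c
    using that by (simp add: abs_inner_commute)
  show "abs_inner (\<gamma> a) (\<gamma> c) \<noteq> 0"
    if nz: "abs_inner (\<gamma> a) (\<gamma> b) \<noteq> 0" "abs_inner (\<gamma> b) (\<gamma> c) \<noteq> 0" for a b c
  proof (cases "a = b \<or> c = b")
    case False
    then have "\<gamma> a \<noteq> \<gamma> b" "\<gamma> c \<noteq> \<gamma> b"
      using inj by (auto dest: injD)
    then have "p\<^sup>2 * q\<^sup>2 + q\<^sup>2 * r\<^sup>2 + r\<^sup>2 * p\<^sup>2 - p\<^sup>2 * q\<^sup>2 * r\<^sup>2 = 2 * (p * q * r)"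
      if "p = abs_inner (\<gamma> b) (\<gamma> a)" "q = abs_inner (\<gamma> b) (\<gamma> c)" "r = abs_inner (\<gamma> a) (\<gamma> c)"
      for p q r
      by (intro unchanged_triple_identity[OF unch _ _ _ _ _ _ that]) (use \<gamma> in auto)
    \<comment> \<open>With \<open>r = 0\<close> the identity, centred at \<open>\<gamma> b\<close>,
      would reduce to \<open>p\<^sup>2 * q\<^sup>2 = 0\<close>.\<close>
    from this[OF refl refl refl] nz show ?thesis
      by (auto simp: abs_inner_commute)
  qed (use nz in auto)
  show "\<exists>T. openin (top_of_set UNIV) T \<and> a \<in> T \<and> (\<forall>t\<in>T. abs_inner (\<gamma> a) (\<gamma> t) \<noteq> 0)" for a
  proof (intro exI conjI)
    have "continuous_on UNIV (\<lambda>t. abs_inner (\<gamma> a) (\<gamma> t))"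
      using continuous_on_compose2[OF continuous_on_abs_inner_curve[OF cont], of UNIV "\<lambda>t. (a, t)"]
      by (simp add: continuous_on_Pair continuous_on_const continuous_on_id)
    then show "openin (top_of_set UNIV) {t. abs_inner (\<gamma> a) (\<gamma> t) \<noteq> 0}"
      by (simp add: open_Collect_neq continuous_on_const)
    show "a \<in> {t. abs_inner (\<gamma> a) (\<gamma> t) \<noteq> 0}"
      using abs_inner_proj_eq_one_iff[OF \<gamma> \<gamma>, of a a] by simp
  qed auto
qed auto

text \<open>Since no two points are orthogonal, the hyperbolic distance \<open>d\<close> is finite
  and continuous. Injectivity makes it positive for distinct parameters, and the triple identity
  makes it degenerate.\<close>

lemma unchanged_curve_coordinate:
  assumes cont: "continuous_map euclideanreal proj_topology \<gamma>"
    and inj: "inj \<gamma>"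
    and unch: "isometry_type_unchanged (range \<gamma>)"
  obtains u :: "real \<Rightarrow> real" where "continuous_on UNIV u" "inj u"
    "\<And>s t. abs_inner (\<gamma> s) (\<gamma> t) = 1 / cosh (u s - u t)"
proof -
  interpret Metric_space "proj_space :: 'a set set" rho
    by (rule Metric_space_proj)
  define k where "k s t = abs_inner (\<gamma> s) (\<gamma> t)" for s t
  have \<gamma>: "\<gamma> t \<in> proj_space" for t
    using cont by (auto simp: continuous_map_def)
  have k: "0 < k s t" "k s t \<le> 1" for s t
    using unchanged_curve_not_orthogonal[OF assms, of s t] abs_inner_bounds[OF \<gamma> \<gamma>, of s t]
    by (auto simp: k_def)
  then have ge: "1 / k s t \<ge> 1" for s t
    by simp
  have one: "k s t = 1 \<longleftrightarrow> s = t" for s t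
    using abs_inner_proj_eq_one_iff[OF \<gamma> \<gamma>] inj by (auto simp: k_def dest: injD)
  have sym: "k s t = k t s" for s t
    by (simp add: k_def abs_inner_commute)
  define d where "d s t = arcosh (1 / k s t)" for s t
  obtain u where u: "continuous_on UNIV u" "inj u" "\<And>s t. d s t = \<bar>u s - u t\<bar>"
  proof (rule degenerate_metric_coordinate[of d])
    have k_cont: "continuous_on UNIV (\<lambda>x. k (fst x) (snd x))"
      using continuous_on_abs_inner_curve[OF cont] by (simp add: case_prod_unfold k_def)
    show "continuous_on UNIV (\<lambda>(s, t). d s t)"
      unfolding d_def case_prod_unfold
      by (intro continuous_on_compose2[OF continuous_on_arcosh[OF order.refl]]
          continuous_on_divide continuous_on_const k_cont)
        (use k ge in \<open>auto simp: less_imp_neq[symmetric]\<close>)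
    show "d t t = 0" for t
      using one[of t t] by (simp add: d_def)
    show "d s t = d t s" for s t
      by (simp add: d_def sym)
    show "d s t > 0" if "s < t" for s t
      unfolding d_def using that one[of s t] ge[of s t]
      by (subst arcosh_real_gt_1_iff) auto
    show "d b c = d a b + d a c \<or> d a b = d a c + d b c \<or> d a c = d a b + d b c"
      if "a < b" "b < c" for a b c
    proof -
      have "\<gamma> b \<noteq> \<gamma> a" "\<gamma> c \<noteq> \<gamma> a"
        using that by (simp_all add: inj_eq[OF inj])
      moreover have "range \<gamma> \<subseteq> proj_space"
        using \<gamma> by blast
      ultimately have "(k a b)\<^sup>2 * (k a c)\<^sup>2 + (k a c)\<^sup>2 * (k b c)\<^sup>2 + (k b c)\<^sup>2 * (k a b)\<^sup>2
          - (k a b)\<^sup>2 * (k a c)\<^sup>2 * (k b c)\<^sup>2 = 2 * (k a b * k a c * k b c)"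
        by (intro unchanged_triple_identity[OF unch _ rangeI rangeI rangeI _ _ k_def k_def k_def])
      then show ?thesis
        unfolding d_def by (rule arcosh_triple_degenerate) (rule k)+
    qed
  qed blast
  have "k s t = 1 / cosh (u s - u t)" for s t
  proof -
    have "cosh (u s - u t) = cosh (d s t)"
      by (simp add: u)
    also have "\<dots> = 1 / k s t"
      unfolding d_def using ge by (rule cosh_arcosh_real)
    finally show ?thesis
      by simp
  qed
  then show thesis
    using u that by (simp add: k_def)
qed

text \<open>The witness for \<open>J\<close> is the range of the coordinate \<open>u\<close>, and
  the isometry sends \<open>\<gamma> t\<close> to \<open>h (u t)\<close>.\<close>

theorem corollary1p7:
  fixes \<gamma> :: "real \<Rightarrow> 'a::{real_inner,complete_space} set"
    and h :: "real \<Rightarrow> 'b::{real_inner,complete_space} set"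
  assumes "continuous_map euclideanreal proj_topology \<gamma>"
    and "inj \<gamma>"
    and "isometry_type_unchanged (range \<gamma>)"
    and "helix h"
  shows "\<exists>J :: real set. open J \<and> is_interval J \<and> J \<noteq> {} \<and> rho_isometric (range \<gamma>) (h ` J)"
proof -
  obtain u :: "real \<Rightarrow> real" where u: "continuous_on UNIV u" "inj u"
    and k: "\<And>s t. abs_inner (\<gamma> s) (\<gamma> t) = 1 / cosh (u s - u t)"
    using unchanged_curve_coordinate assms(1-3) by blast
  interpret Metric_space "proj_space :: 'a set set" rho
    by (rule Metric_space_proj)
  have \<gamma>: "\<gamma> t \<in> proj_space" for t
    using assms(1) by (auto simp: continuous_map_def)
  have h: "h t \<in> proj_space" "abs_inner (h s) (h t) = 1 / cosh (t - s)" for s t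
    using assms(4) by (auto simp: helix_def)
  have "inj h"
  proof (rule injI)
    fix s t assume "h s = h t"
    then have "1 / cosh (t - s) = 1"
      using h abs_inner_proj_eq_one_iff by metis
    then have "cosh (t - s) = cosh 0"
      by simp
    then show "s = t"
      unfolding cosh_real_eq_iff by simp
  qed
  \<comment> \<open>Injectivity of \<open>\<gamma>\<close> lets the parameter be recovered from the
    point.\<close>
  define f where "f = h \<circ> u \<circ> the_inv \<gamma>"
  have f: "f (\<gamma> t) = h (u t)" for t
    by (simp add: f_def the_inv_f_f assms(2))
  have "inj_on f (range \<gamma>)"
    using \<open>inj h\<close> u(2) by (auto simp: inj_on_def f dest!: injD)
  moreover have "f ` range \<gamma> = h ` range u"
    by (simp add: image_image f)
  moreover have "rho (f P) (f Q) = rho P Q" if "P \<in> range \<gamma>" "Q \<in> range \<gamma>" for P Q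
    using that by (auto simp: f rho_def \<gamma> h k) (metis cosh_minus minus_diff_eq)
  ultimately have "rho_isometric (range \<gamma>) (h ` range u)"
    unfolding rho_isometric_def bij_betw_def by blast
  \<comment> \<open>A continuous injective real function on the line is an open map, so the interval
    has no endpoints of its own.\<close>
  moreover have "open (range u)"
    using injective_eq_1d_open_map_UNIV[OF u(1)] u(2) by (auto simp: is_interval_univ)
  moreover have "is_interval (range u)"
    using connected_continuous_image[OF u(1)] by (simp add: is_interval_connected_1)
  ultimately show ?thesis
    by blast
qed

end
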